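(* Let $a,b,c,d\in\mathbb{R}$ with $ad\neq 0$. The origin of the Generalized Lorenz system $$\dot x=a(y-x),\qquad \dot y=bx+cy-xz,\qquad \dot z=dz+xy$$ is a nilpotent center on a center manifold if and only if $b=-a$, $c=a$, $d=-2a$.
   Context: A singular point of a three-dimensional analytic system is nilpotent if, after a translation and a linear change of variables, the linear part of the system at it is $\dot x=y$, $\dot y=0$, $\dot z=-\lambda z$ with $\lambda\neq 0$. In these coordinates a center manifold is an invariant surface $z=h(x,y)$ through the singular point tangent to the $xy$-plane there, with $h$ of class $C^r$ ($r$ any finite integer as large as needed). A nilpotent singular point is a nilpotent center on a center manifold if, for the system restricted to the center manifold, some punctured neighborhood of the point is filled with periodic orbits surrounding it. *)

theory Defs
  imports "HOL-Analysis.Analysis"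
begin

text \<open>The vector field of the system, on \<open>\<real>\<^sup>3\<close> rendered as \<^typ>\<open>real \<times> real \<times> real\<close>.\<close>

definition lorenz :: "real \<Rightarrow> real \<Rightarrow> real \<Rightarrow> real \<Rightarrow> real \<times> real \<times> real \<Rightarrow> real \<times> real \<times> real" where
  "lorenz a b c d = (\<lambda>(x, y, z). (a * (y - x), b * x + c * y - x * z, d * z + x * y))"

definition solution_on :: "real set \<Rightarrow> ('a::real_normed_vector \<Rightarrow> 'a) \<Rightarrow> (real \<Rightarrow> 'a) \<Rightarrow> bool" where
  "solution_on J F \<gamma> \<longleftrightarrow> (\<forall>t\<in>J. (\<gamma> has_vector_derivative F (\<gamma> t)) (at t within J))"

text \<open>Functions of class \<open>C\<^sup>r\<close> on \<open>S\<close>; to be used for open \<open>S\<close> only.\<close>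

fun class_C :: "nat \<Rightarrow> 'a::euclidean_space set \<Rightarrow> ('a \<Rightarrow> real) \<Rightarrow> bool" where
  "class_C 0 S f \<longleftrightarrow> continuous_on S f"
| "class_C (Suc r) S f \<longleftrightarrow>
     (\<forall>x\<in>S. f differentiable (at x)) \<and>
     (\<forall>v\<in>Basis. class_C r S (\<lambda>x. frechet_derivative f (at x) v))"

text \<open>The vector field \<open>F\<close> in the coordinates \<open>w = P (q - p)\<close>.\<close>

definition transformed ::
  "('a::real_vector \<Rightarrow> 'a) \<Rightarrow> 'a \<Rightarrow> ('a \<Rightarrow> 'a) \<Rightarrow> 'a \<Rightarrow> 'a" where
  "transformed P p F = (\<lambda>w. P (F (p + inv P w)))"

text \<open>\<open>p\<close> is a nilpotent singular point of \<open>F\<close>, as witnessed by the linear change of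
  variables \<open>P\<close> and the number \<open>\<mu>\<close>, called \<open>\<lambda>\<close> in the usual normal form
  \<open>\<lambda>(x, y, z). (y, 0, -\<lambda> z)\<close>.\<close>

definition nilpotent_coords ::
  "(real \<times> real \<times> real \<Rightarrow> real \<times> real \<times> real) \<Rightarrow> real \<times> real \<times> real \<Rightarrow>
   (real \<times> real \<times> real \<Rightarrow> real \<times> real \<times> real) \<Rightarrow> real \<Rightarrow> bool" where
  "nilpotent_coords F p P \<mu> \<longleftrightarrow>
     F p = 0 \<and> linear P \<and> bij P \<and> \<mu> \<noteq> 0 \<and>
     (transformed P p F has_derivative (\<lambda>(x, y, z). (y, 0, - \<mu> * z))) (at 0)"

definition graph_over :: "(real \<times> real) set \<Rightarrow> (real \<times> real \<Rightarrow> real) \<Rightarrow> (real \<times> real \<times> real) set" where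
  "graph_over U h = {(x, y, h (x, y)) | x y. (x, y) \<in> U}"

text \<open>Local invariance of the graph of \<open>h\<close> over \<open>U\<close>: a solution meeting the graph can leave it,
  in either time direction, only by its \<open>(x, y)\<close>-projection leaving \<open>U\<close>.\<close>

definition invariant_graph ::
  "(real \<times> real \<times> real \<Rightarrow> real \<times> real \<times> real) \<Rightarrow> (real \<times> real) set \<Rightarrow> (real \<times> real \<Rightarrow> real) \<Rightarrow> bool" where
  "invariant_graph G U h \<longleftrightarrow>
     (\<forall>J \<gamma>. is_interval J \<and> solution_on J G \<gamma> \<and>
        (\<exists>s\<in>J. \<gamma> s \<in> graph_over U h) \<and>
        (\<forall>t\<in>J. (fst (\<gamma> t), fst (snd (\<gamma> t))) \<in> U) \<longrightarrow>
        (\<forall>t\<in>J. \<gamma> t \<in> graph_over U h))"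

text \<open>\<open>G\<close> is a vector field with nilpotent linear part in normal form at the origin.\<close>

definition center_manifold ::
  "nat \<Rightarrow> (real \<times> real \<times> real \<Rightarrow> real \<times> real \<times> real) \<Rightarrow> (real \<times> real) set \<Rightarrow> (real \<times> real \<Rightarrow> real) \<Rightarrow> bool" where
  "center_manifold r G U h \<longleftrightarrow>
     open U \<and> 0 \<in> U \<and> class_C r U h \<and>
     h 0 = 0 \<and> (h has_derivative (\<lambda>_. 0)) (at 0) \<and>
     invariant_graph G U h"

definition restricted ::
  "(real \<times> real \<times> real \<Rightarrow> real \<times> real \<times> real) \<Rightarrow> (real \<times> real \<Rightarrow> real) \<Rightarrow> real \<times> real \<Rightarrow> real \<times> real" where
  "restricted G h = (\<lambda>(x, y). (fst (G (x, y, h (x, y))), fst (snd (G (x, y, h (x, y))))))"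

text \<open>The planar vector field \<open>f\<close>, defined on \<open>U\<close>, has a center at \<open>p\<close>. An orbit surrounds \<open>p\<close>
  if \<open>p\<close> lies in a bounded component of its complement; since no point of the plane lies inside
  a singleton, equilibria are excluded.\<close>

definition planar_center :: "(real \<times> real) set \<Rightarrow> (real \<times> real \<Rightarrow> real \<times> real) \<Rightarrow> real \<times> real \<Rightarrow> bool" where
  "planar_center U f p \<longleftrightarrow>
     (\<exists>V. open V \<and> p \<in> V \<and> V \<subseteq> U \<and>
       (\<forall>q\<in>V - {p}. \<exists>\<gamma> T. T > 0 \<and> solution_on UNIV f \<gamma> \<and> \<gamma> 0 = q \<and>
          (\<forall>t. \<gamma> (t + T) = \<gamma> t) \<and> range \<gamma> \<subseteq> V - {p} \<and> p \<in> inside (range \<gamma>)))"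

definition nilpotent_center_on_center_manifold ::
  "nat \<Rightarrow> (real \<times> real \<times> real \<Rightarrow> real \<times> real \<times> real) \<Rightarrow> real \<times> real \<times> real \<Rightarrow> bool" where
  "nilpotent_center_on_center_manifold r F p \<longleftrightarrow>
     (\<exists>P \<mu>. nilpotent_coords F p P \<mu> \<and>
       (\<exists>U h. center_manifold r (transformed P p F) U h \<and>
          planar_center U (restricted (transformed P p F) h) 0))"

end

theory Submission
  imports Defs
begin

text \<open>A normal form of the linear part forces \<open>b = - a\<close>, \<open>c = a\<close>.  Let \<open>u = y - x\<close>.

  If \<open>d \<noteq> - 2 a\<close>, then a quantity \<open>L\<close>, polynomial in \<open>x, u, z\<close>, has derivative \<open>L' = d w\<^sup>2\<close> with
  \<open>w = z + x\<^sup>2 / d\<close> along solutions.  It is constant on periodic orbits, so \<open>w\<close> vanishes there,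
  and this leaves only the equilibrium at the origin; a center, however, has nonconstant
  periodic orbits, which lift from the center manifold to space.  The lifting needs the
  differential equation for \<open>h\<close>, obtained by differentiating along local solutions.

  If \<open>d = - 2 a\<close>, then \<open>z = x\<^sup>2 / (2 a)\<close> is an invariant surface.  In the coordinates \<open>(x, a u)\<close>
  the restricted system is the Hamiltonian system \<open>x' = y\<close>, \<open>y' = - x\<^sup>3 / 2\<close>, whose energy is
  positive definite.\<close>


section \<open>The system in components\<close>

lemma solution_lorenz_iff:
  "solution_on J (lorenz a b c d) \<gamma> \<longleftrightarrow>
     (\<forall>t\<in>J.
        ((\<lambda>s. fst (\<gamma> s)) has_real_derivative a * (fst (snd (\<gamma> t)) - fst (\<gamma> t))) (at t within J) \<and>
        ((\<lambda>s. fst (snd (\<gamma> s))) has_real_derivative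
           b * fst (\<gamma> t) + c * fst (snd (\<gamma> t)) - fst (\<gamma> t) * snd (snd (\<gamma> t))) (at t within J) \<and>
        ((\<lambda>s. snd (snd (\<gamma> s))) has_real_derivative
           d * snd (snd (\<gamma> t)) + fst (\<gamma> t) * fst (snd (\<gamma> t))) (at t within J))"
  (is "_ \<longleftrightarrow> (\<forall>t\<in>J. ?D t)")
  unfolding solution_on_def
proof (intro ball_cong refl iffI)
  fix t
  assume D: "(\<gamma> has_vector_derivative lorenz a b c d (\<gamma> t)) (at t within J)"
  note fst' = bounded_linear.has_vector_derivative[OF bounded_linear_fst]
  note snd' = bounded_linear.has_vector_derivative[OF bounded_linear_snd]
  show "?D t"
    using fst'[OF D] fst'[OF snd'[OF D]] snd'[OF snd'[OF D]]
    by (simp add: has_real_derivative_iff_has_vector_derivative lorenz_def split_beta)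
next
  fix t
  assume "?D t"
  then have "((\<lambda>s. (fst (\<gamma> s), fst (snd (\<gamma> s)), snd (snd (\<gamma> s)))) has_vector_derivative
      lorenz a b c d (\<gamma> t)) (at t within J)"
    unfolding has_real_derivative_iff_has_vector_derivative lorenz_def split_beta
    by (intro has_vector_derivative_Pair) auto
  then show "(\<gamma> has_vector_derivative lorenz a b c d (\<gamma> t)) (at t within J)"
    by simp
qed

subsection \<open>Local solutions by power series\<close>

text \<open>Taylor coefficients at time 0 of the solution starting at \<open>p\<close>: comparing
  coefficients in the differential equation turns the products \<open>x z\<close> and
  \<open>x y\<close> into convolutions.\<close>

fun lorenz_coeff :: "real \<Rightarrow> real \<Rightarrow> real \<Rightarrow> real \<Rightarrow> real \<times> real \<times> real \<Rightarrow> nat \<Rightarrow> real \<times> real \<times> real" where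
  "lorenz_coeff a b c d p 0 = p"
| "lorenz_coeff a b c d p (Suc n) =
    (a * (fst (snd (lorenz_coeff a b c d p n)) - fst (lorenz_coeff a b c d p n)) / real (Suc n),
     (b * fst (lorenz_coeff a b c d p n) + c * fst (snd (lorenz_coeff a b c d p n))
       - (\<Sum>k\<in>{..n}. fst (lorenz_coeff a b c d p k) * snd (snd (lorenz_coeff a b c d p (n - k)))))
       / real (Suc n),
     (d * snd (snd (lorenz_coeff a b c d p n))
       + (\<Sum>k\<in>{..n}. fst (lorenz_coeff a b c d p k) * fst (snd (lorenz_coeff a b c d p (n - k)))))
       / real (Suc n))"

lemma sum_convolution_bound:
  fixes f g :: "nat \<Rightarrow> real"
  assumes "\<And>k. k \<le> n \<Longrightarrow> \<bar>f k\<bar> \<le> K * M ^ k" "\<And>k. k \<le> n \<Longrightarrow> \<bar>g k\<bar> \<le> K * M ^ k" "0 \<le> K" "0 \<le> M"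
  shows "\<bar>\<Sum>k\<le>n. f k * g (n - k)\<bar> \<le> real (Suc n) * (K\<^sup>2 * M ^ n)"
proof -
  have "\<bar>f k * g (n - k)\<bar> \<le> K\<^sup>2 * M ^ n" if "k \<le> n" for k
  proof -
    have "\<bar>f k * g (n - k)\<bar> \<le> (K * M ^ k) * (K * M ^ (n - k))"
      unfolding abs_mult using assms that by (intro mult_mono) auto
    also have "\<dots> = K\<^sup>2 * (M ^ k * M ^ (n - k))"
      by (simp add: power2_eq_square)
    also have "M ^ k * M ^ (n - k) = M ^ n"
      using that by (simp flip: power_add)
    finally show ?thesis .
  qed
  then have "\<bar>\<Sum>k\<le>n. f k * g (n - k)\<bar> \<le> (\<Sum>k\<le>n. K\<^sup>2 * M ^ n)"
    by (intro order_trans[OF sum_abs] sum_mono) auto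
  then show ?thesis
    by simp
qed

text \<open>The convolution of order \<open>n\<close> has \<open>n + 1\<close> terms, and the
  recursion divides by \<open>n + 1\<close>. One step therefore multiplies the bound by at most the
  sum of the linear coefficients plus \<open>K p\<close>, which the ratio \<open>M p\<close>
  dominates; the summand 1 keeps \<open>M p\<close> positive. Strong induction is used since a
  convolution involves all earlier coefficients.\<close>

lemma lorenz_coeff_bound:
  fixes a b c d :: real
  defines "K \<equiv> \<lambda>p. norm p"
  defines "M \<equiv> \<lambda>p. 2 * \<bar>a\<bar> + \<bar>b\<bar> + \<bar>c\<bar> + \<bar>d\<bar> + K p + 1"
  shows "\<bar>fst (lorenz_coeff a b c d p n)\<bar> \<le> K p * M p ^ n \<and>
     \<bar>fst (snd (lorenz_coeff a b c d p n))\<bar> \<le> K p * M p ^ n \<and>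
     \<bar>snd (snd (lorenz_coeff a b c d p n))\<bar> \<le> K p * M p ^ n"
proof (induction n rule: less_induct)
  case (less n)
  define x where "x = (\<lambda>k. fst (lorenz_coeff a b c d p k))"
  define y where "y = (\<lambda>k. fst (snd (lorenz_coeff a b c d p k)))"
  define z where "z = (\<lambda>k. snd (snd (lorenz_coeff a b c d p k)))"
  have K: "0 \<le> K p" and M: "0 \<le> M p"
    by (auto simp: K_def M_def)
  show ?case
  proof (cases n)
    case 0
    have "\<bar>fst p\<bar> \<le> norm p" "norm (snd p) \<le> norm p"
         "\<bar>fst (snd p)\<bar> \<le> norm (snd p)" "\<bar>snd (snd p)\<bar> \<le> norm (snd p)"
      using norm_fst_le[of "fst p" "snd p"] norm_snd_le[of "snd p" "fst p"]
        norm_fst_le[of "fst (snd p)" "snd (snd p)"] norm_snd_le[of "snd (snd p)" "fst (snd p)"] by simp_all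
    then show ?thesis
      using 0 by (auto simp: K_def)
  next
    case (Suc m)
    have x: "\<bar>x k\<bar> \<le> K p * M p ^ k" and y: "\<bar>y k\<bar> \<le> K p * M p ^ k" and z: "\<bar>z k\<bar> \<le> K p * M p ^ k"
      if "k \<le> m" for k
      using less[of k] that Suc unfolding x_def y_def z_def by auto
    define B where "B = K p * M p ^ m"
    have B: "0 \<le> B"
      using K M by (simp add: B_def)
    \<comment> \<open>\<open>C\<close> collects the linear coefficients of one equation; the other
      summand is the bound for a convolution.\<close>
    have step: "\<bar>u / real (Suc m)\<bar> \<le> K p * M p ^ n"
      if "\<bar>u\<bar> \<le> C * B + real (Suc m) * (K p * B)" "0 \<le> C" "C \<le> 2 * \<bar>a\<bar> + \<bar>b\<bar> + \<bar>c\<bar> + \<bar>d\<bar>" for u C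
    proof -
      have "C * B * 1 \<le> C * B * real (Suc m)"
        using that B by (intro mult_left_mono) auto
      then have "\<bar>u\<bar> \<le> real (Suc m) * ((C + K p) * B)"
        using that by (simp add: algebra_simps)
      also have "\<dots> \<le> real (Suc m) * (M p * B)"
        using that B by (intro mult_left_mono mult_right_mono) (auto simp: M_def)
      also have "M p * B = K p * M p ^ n"
        using Suc by (simp add: B_def)
      finally show ?thesis
        by (simp add: abs_divide field_simps)
    qed
    have s: "\<bar>e * v\<bar> \<le> \<bar>e\<bar> * B" if "\<bar>v\<bar> \<le> B" for e v
      using that by (auto simp: abs_mult intro!: mult_left_mono)
    have vm: "\<bar>x m\<bar> \<le> B" "\<bar>y m\<bar> \<le> B" "\<bar>z m\<bar> \<le> B"
      using x y z by (auto simp: B_def)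
    have KB: "K p * B = (K p)\<^sup>2 * M p ^ m"
      by (simp add: B_def power2_eq_square)
    have xz: "\<bar>\<Sum>k\<le>m. x k * z (m - k)\<bar> \<le> real (Suc m) * (K p * B)"
      and xy: "\<bar>\<Sum>k\<le>m. x k * y (m - k)\<bar> \<le> real (Suc m) * (K p * B)"
      unfolding KB by (intro sum_convolution_bound x y z K M; assumption)+
    \<comment> \<open>The first equation has no quadratic term; the nonnegative summand is added to
      fit \<open>step\<close>.\<close>
    have "\<bar>a * (y m - x m)\<bar> \<le> (2 * \<bar>a\<bar>) * B + real (Suc m) * (K p * B)"
      using s[OF vm(1), of a] s[OF vm(2), of a] mult_nonneg_nonneg[OF of_nat_0_le_iff mult_nonneg_nonneg[OF K B], of "Suc m"]
      unfolding right_diff_distrib by linarith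
    from step[OF this] have 1: "\<bar>fst (lorenz_coeff a b c d p n)\<bar> \<le> K p * M p ^ n"
      using Suc by (simp add: x_def y_def)
    have "\<bar>b * x m + c * y m - (\<Sum>k\<le>m. x k * z (m - k))\<bar> \<le> (\<bar>b\<bar> + \<bar>c\<bar>) * B + real (Suc m) * (K p * B)"
      using s[OF vm(1), of b] s[OF vm(2), of c] xz by (simp only: distrib_right)
    from step[OF this] have 2: "\<bar>fst (snd (lorenz_coeff a b c d p n))\<bar> \<le> K p * M p ^ n"
      using Suc by (simp add: x_def y_def z_def)
    have "\<bar>d * z m + (\<Sum>k\<le>m. x k * y (m - k))\<bar> \<le> \<bar>d\<bar> * B + real (Suc m) * (K p * B)"
      using s[OF vm(3), of d] xy by linarith
    from step[OF this] have 3: "\<bar>snd (snd (lorenz_coeff a b c d p n))\<bar> \<le> K p * M p ^ n"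
      using Suc by (simp add: x_def y_def z_def)
    from 1 2 3 show ?thesis
      by blast
  qed
qed

lemma summable_powser_geometric_bound:
  fixes f :: "nat \<Rightarrow> real"
  assumes "\<And>n. \<bar>f n\<bar> \<le> K * M ^ n" "0 < M" "\<bar>t\<bar> < 1 / M"
  shows "summable (\<lambda>n. norm (f n * t ^ n))"
proof (rule summable_comparison_test')
  show "summable (\<lambda>n. K * (M * \<bar>t\<bar>) ^ n)"
    using assms by (intro summable_mult summable_geometric) (auto simp: field_simps abs_mult)
  show "norm (norm (f n * t ^ n)) \<le> K * (M * \<bar>t\<bar>) ^ n" for n
    using mult_right_mono[OF assms(1)[of n], of "\<bar>t\<bar> ^ n"]
    by (simp add: abs_mult power_abs power_mult_distrib mult.assoc)
qed

lemma powser_mult: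
  fixes f g :: "nat \<Rightarrow> real"
  assumes "summable (\<lambda>n. norm (f n * t ^ n))" "summable (\<lambda>n. norm (g n * t ^ n))"
  shows "(\<lambda>n. (\<Sum>k\<le>n. f k * g (n - k)) * t ^ n) sums ((\<Sum>n. f n * t ^ n) * (\<Sum>n. g n * t ^ n))"
proof -
  have "(\<Sum>k\<le>n. (f k * t ^ k) * (g (n - k) * t ^ (n - k))) = (\<Sum>k\<le>n. f k * g (n - k)) * t ^ n" for n
    unfolding sum_distrib_right
    by (intro sum.cong refl) (simp add: mult_ac flip: power_add)
  then show ?thesis
    using Cauchy_product_sums[OF assms] by simp
qed

text \<open>The geometric bound on the coefficients makes the three series converge for
  \<open>\<bar>t\<bar> < 1 / M\<close>, where they may be differentiated termwise and multiplied by
  Cauchy products.\<close>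

lemma lorenz_local_solution:
  "\<exists>e>0. \<exists>\<gamma>. \<gamma> 0 = p \<and> solution_on {-e<..<e} (lorenz a b c d) \<gamma>"
proof -
  define x where "x = (\<lambda>k. fst (lorenz_coeff a b c d p k))"
  define y where "y = (\<lambda>k. fst (snd (lorenz_coeff a b c d p k)))"
  define z where "z = (\<lambda>k. snd (snd (lorenz_coeff a b c d p k)))"
  define K where "K = norm p"
  define M where "M = 2 * \<bar>a\<bar> + \<bar>b\<bar> + \<bar>c\<bar> + \<bar>d\<bar> + K + 1"
  have M: "M > 0"
    by (simp add: M_def K_def add_nonneg_pos)
  have bound: "\<bar>x n\<bar> \<le> K * M ^ n" "\<bar>y n\<bar> \<le> K * M ^ n" "\<bar>z n\<bar> \<le> K * M ^ n" for n
    using lorenz_coeff_bound[of a b c d p n] unfolding x_def y_def z_def K_def M_def by auto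
  \<comment> \<open>\<open>diffs\<close> multiplies the next coefficient by \<open>n + 1\<close>,
    which cancels the division in the recursion.\<close>
  have dx: "diffs x n = a * (y n - x n)"
    and dy: "diffs y n = b * x n + c * y n - (\<Sum>k\<le>n. x k * z (n - k))"
    and dz: "diffs z n = d * z n + (\<Sum>k\<le>n. x k * y (n - k))" for n
    by (simp_all add: diffs_def x_def y_def z_def)
  define X where "X = (\<lambda>t. \<Sum>n. x n * t ^ n)"
  define Y where "Y = (\<lambda>t. \<Sum>n. y n * t ^ n)"
  define Z where "Z = (\<lambda>t. \<Sum>n. z n * t ^ n)"
  define \<gamma> where "\<gamma> = (\<lambda>t. (X t, Y t, Z t))"
  have D: "((\<lambda>t. \<Sum>n. f n * t ^ n) has_real_derivative l) (at t within S)"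
    if "\<And>n. \<bar>f n\<bar> \<le> K * M ^ n" "\<bar>t\<bar> < 1 / M" "(\<lambda>n. diffs f n * t ^ n) sums l" for f t l S
    using termdiffs_strong'[of "1 / M" f t] summable_norm_cancel[OF summable_powser_geometric_bound[OF that(1) M]] that(2,3)
    by (auto simp: sums_iff intro: DERIV_subset)
  have "solution_on {-(1/M)<..<1/M} (lorenz a b c d) \<gamma>"
    unfolding solution_lorenz_iff \<gamma>_def fst_conv snd_conv
  proof (intro ballI conjI)
    fix t :: real
    assume "t \<in> {-(1/M)<..<1/M}"
    then have t: "\<bar>t\<bar> < 1 / M"
      by auto
    note sm = summable_powser_geometric_bound[OF bound(1) M t]
      summable_powser_geometric_bound[OF bound(2) M t]
      summable_powser_geometric_bound[OF bound(3) M t]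
    have s: "(\<lambda>n. x n * t ^ n) sums X t" "(\<lambda>n. y n * t ^ n) sums Y t" "(\<lambda>n. z n * t ^ n) sums Z t"
      using sm[THEN summable_norm_cancel] unfolding X_def Y_def Z_def by (auto simp: summable_sums)
    have xz: "(\<lambda>n. (\<Sum>k\<le>n. x k * z (n - k)) * t ^ n) sums (X t * Z t)"
      and xy: "(\<lambda>n. (\<Sum>k\<le>n. x k * y (n - k)) * t ^ n) sums (X t * Y t)"
      using powser_mult[OF sm(1) sm(3)] powser_mult[OF sm(1) sm(2)] unfolding X_def Y_def Z_def by auto
    show "(X has_real_derivative a * (Y t - X t)) (at t within {-(1/M)<..<1/M})"
      unfolding X_def
      using sums_mult[OF sums_diff[OF s(2) s(1)], of a]
      by (intro D bound t) (simp add: dx X_def algebra_simps)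
    show "(Y has_real_derivative b * X t + c * Y t - X t * Z t) (at t within {-(1/M)<..<1/M})"
      using sums_diff[OF sums_add[OF sums_mult[OF s(1), of b] sums_mult[OF s(2), of c]] xz]
      by (subst Y_def, intro D bound t) (simp add: dy algebra_simps)
    show "(Z has_real_derivative d * Z t + X t * Y t) (at t within {-(1/M)<..<1/M})"
      using sums_add[OF sums_mult[OF s(3), of d] xy]
      by (subst Z_def, intro D bound t) (simp add: dz algebra_simps)
  qed
  moreover have "\<gamma> 0 = p"
    by (simp add: \<gamma>_def X_def Y_def Z_def x_def y_def z_def)
  ultimately show ?thesis
    using M by (intro exI[of _ "1 / M"]) auto
qed

subsection \<open>Absence of periodic orbits\<close>

text \<open>Such an \<open>f\<close> is nondecreasing, yet takes equal values at the two ends of the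
  window of length \<open>T\<close> centered at \<open>t\<close>; hence it is constant on that
  window.\<close>

lemma has_real_derivative_nonneg_periodic_eq_0:
  fixes f f' :: "real \<Rightarrow> real"
  assumes D: "\<And>t. (f has_real_derivative f' t) (at t)"
    and nonneg: "\<And>t. 0 \<le> f' t" and per: "\<And>t. f (t + T) = f t" and T: "0 < T"
  shows "f' t = 0"
proof (rule DERIV_local_const[OF D])
  show "0 < T / 2"
    using T by simp
  have mono: "f s \<le> f t" if "s \<le> t" for s t
    using DERIV_nonneg_imp_nondecreasing[OF that] D nonneg by blast
  show "\<forall>s. \<bar>t - s\<bar> < T / 2 \<longrightarrow> f t = f s"
  proof (intro allI impI)
    fix s
    assume "\<bar>t - s\<bar> < T / 2"
    then have "s \<le> t + T / 2" "t \<le> t + T / 2" "t - T / 2 \<le> s" "t - T / 2 \<le> t"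
      using T by linarith+
    moreover have "f (t - T / 2) = f (t + T / 2)"
      using per[of "t - T / 2"] by (simp add: algebra_simps flip: add_divide_distrib)
    ultimately show "f t = f s"
      using mono[of "t - T / 2" s] mono[of s "t + T / 2"] mono[of "t - T / 2" t] mono[of t "t + T / 2"]
      by linarith
  qed
qed

text \<open>In terms of \<open>u = y - x\<close>, \<open>w = z + x\<^sup>2 / d\<close> and \<open>k = 1 + 2 a / d\<close> the system gives
  \<open>w' = d w + k x u\<close> and \<open>E' = - x u w\<close> for \<open>E = u\<^sup>2 / 2 - x\<^sup>4 / (4 a d)\<close>.  Eliminating \<open>x u\<close>
  yields \<open>(k E + w\<^sup>2 / 2)' = d w\<^sup>2\<close>.\<close>

lemma lorenz_periodic_solution_trivial:
  assumes sol: "solution_on UNIV (lorenz a (-a) a d) \<gamma>" and per: "\<And>t. \<gamma> (t + T) = \<gamma> t" and T: "0 < T"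
    and a: "a \<noteq> 0" and d: "d \<noteq> 0" and k: "d \<noteq> -2 * a"
  shows "\<gamma> t = 0"
proof -
  define x where "x = (\<lambda>t. fst (\<gamma> t))"
  define u where "u = (\<lambda>t. fst (snd (\<gamma> t)) - fst (\<gamma> t))"
  define z where "z = (\<lambda>t. snd (snd (\<gamma> t)))"
  define w where "w = (\<lambda>t. z t + (x t)\<^sup>2 / d)"
  define k where "k = 1 + 2 * a / d"
  have k0: "k \<noteq> 0"
    using d k by (auto simp: k_def field_simps)
  note sol' = sol[unfolded solution_lorenz_iff, rule_format, OF UNIV_I]
  have x': "(x has_real_derivative a * u t) (at t)" for t
    using sol'[of t] by (simp add: x_def u_def)
  have z': "(z has_real_derivative d * z t + x t * (x t + u t)) (at t)" for t
    using sol'[of t] by (simp add: x_def u_def z_def)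
  have u': "(u has_real_derivative - (x t * z t)) (at t)" for t
  proof -
    have "(u has_real_derivative (- a * fst (\<gamma> t) + a * fst (snd (\<gamma> t)) - fst (\<gamma> t) * snd (snd (\<gamma> t)))
       - a * (fst (snd (\<gamma> t)) - fst (\<gamma> t))) (at t)"
      unfolding u_def using sol'[of t] by (intro DERIV_diff) auto
    then show ?thesis
      by (simp add: x_def z_def algebra_simps)
  qed
  have w': "(w has_real_derivative d * w t + k * (x t * u t)) (at t)" for t
    unfolding w_def using d
    by (auto intro!: derivative_eq_intros x' z' simp: k_def field_simps power2_eq_square)
  \<comment> \<open>Dividing by \<open>d\<close> turns the derivative into \<open>w\<^sup>2\<close>,
    which is nonnegative whatever the sign of \<open>d\<close>.\<close>
  define L where "L = (\<lambda>t. (k * ((u t)\<^sup>2 / 2 - (x t) ^ 4 / (4 * a * d)) + (w t)\<^sup>2 / 2) / d)"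
  have L': "(L has_real_derivative (w t)\<^sup>2) (at t)" for t
  proof -
    have "(L has_real_derivative
       (k * (u t * - (x t * z t) - (x t) ^ 3 * (a * u t) / (a * d)) + w t * (d * w t + k * (x t * u t))) / d) (at t)"
      unfolding L_def using a d by (auto intro!: derivative_eq_intros x' u' w' simp: power3_eq_cube)
    moreover have "- (x t * z t) = (x t) ^ 3 / d - x t * w t"
      using d by (simp add: w_def field_simps power2_eq_square power3_eq_cube)
    ultimately show ?thesis
      using a d by (simp add: field_simps power2_eq_square)
  qed
  have "(w t)\<^sup>2 = 0" for t
    using L'
  proof (rule has_real_derivative_nonneg_periodic_eq_0)
    show "L (t + T) = L t" for t
      by (simp add: L_def w_def x_def u_def z_def per)
  qed (use T in auto)
  then have w: "w t = 0" for t
    by simp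
  have zero: "f' t = 0" if "\<And>t. f t = C" "\<And>t. (f has_real_derivative f' t) (at t)" for f f' :: "real \<Rightarrow> real" and C t
  proof -
    have "f = (\<lambda>_. C)"
      using that by auto
    then show ?thesis
      using that(2)[of t] DERIV_const DERIV_unique by blast
  qed
  \<comment> \<open>With \<open>w\<close> identically zero, the equation for \<open>w'\<close>
    leaves \<open>k x u = 0\<close>, and \<open>k \<noteq> 0\<close> is the assumption
    \<open>d \<noteq> -2 * a\<close>.\<close>
  have xu: "x t * u t = 0" for t
    using zero[of w 0, OF w w'] k0 w by simp
  \<comment> \<open>Since \<open>x\<^sup>2\<close> has derivative \<open>2 a x u = 0\<close>,
    \<open>x\<close> vanishes either always or never; in both cases \<open>u = 0\<close>.\<close>
  have "((\<lambda>t. (x t)\<^sup>2) has_real_derivative 0) (at t)" for t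
    using xu[of t] by (auto intro!: derivative_eq_intros x')
  then have x2: "(x t)\<^sup>2 = (x 0)\<^sup>2" for t
    using DERIV_isconst_all[of "\<lambda>t. (x t)\<^sup>2" t 0] by simp
  have u0: "u t = 0" for t
  proof (cases "x t = 0")
    case True
    then have "x s = 0" for s
      using x2[of t] x2[of s] by simp
    from zero[of x 0, OF this x'] show ?thesis
      using a by simp
  next
    case False
    with xu[of t] show ?thesis
      by simp
  qed
  have "x t * z t = 0"
    using zero[of u 0, OF u0 u'] by simp
  moreover have "z t = - (x t)\<^sup>2 / d"
    using w[of t] by (simp add: w_def)
  ultimately have "x t = 0" "z t = 0"
    using d by auto
  then show ?thesis
    using u0[of t] by (simp add: x_def u_def z_def prod_eq_iff)
qed


subsection \<open>Necessity\<close>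

lemma lorenz_has_derivative_0:
  "(lorenz a b c d has_derivative (\<lambda>(x, y, z). (a * (y - x), b * x + c * y, d * z))) (at 0)"
  unfolding lorenz_def split_beta
  by (auto intro!: derivative_eq_intros simp: algebra_simps)

lemma bij_linear_inv_bounded_linear:
  fixes P :: "'a::euclidean_space \<Rightarrow> 'a"
  assumes "linear P" "bij P"
  shows "bounded_linear (inv P)"
  using assms by (simp add: bij_def inj_linear_imp_inv_bounded_linear linear_conv_bounded_linear)

text \<open>The Jacobian \<open>A\<close> is conjugate to the normal form, so the preimages
  \<open>v1\<close>, \<open>v2\<close> of the first two basis vectors form a Jordan chain:
  \<open>A v1 = 0\<close> and \<open>A v2 = v1 \<noteq> 0\<close>. The first relation makes
  \<open>v1\<close> a multiple of \<open>(1, 1, 0)\<close> and gives \<open>b = - c\<close>; the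
  second then gives \<open>c = a\<close>.\<close>

lemma lorenz_nilpotent_coords_imp:
  assumes nil: "nilpotent_coords (lorenz a b c d) 0 P \<mu>" and a: "a \<noteq> 0" and d: "d \<noteq> 0"
  shows "b = -a \<and> c = a"
proof -
  define A where "A = (\<lambda>(x::real, y::real, z::real). (a * (y - x), b * x + c * y, d * z))"
  define N where "N = (\<lambda>(x::real, y::real, z::real). (y, 0::real, - \<mu> * z))"
  from nil have lP: "linear P" and bij: "bij P"
    and D: "(transformed P 0 (lorenz a b c d) has_derivative N) (at 0)"
    by (auto simp: nilpotent_coords_def N_def)
  have bP: "bounded_linear P"
    using lP by (simp add: linear_conv_bounded_linear)
  note bQ = bij_linear_inv_bounded_linear[OF lP bij]
  have PQ: "P (inv P v) = v" and QP: "inv P (P v) = v" for v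
    using bij by (simp_all add: bij_def surj_f_inv_f)
  have "(lorenz a b c d has_derivative A) (at (inv P 0))"
    using lorenz_has_derivative_0 by (simp add: A_def linear_0[OF bounded_linear.linear[OF bQ]])
  from has_derivative_compose[OF bounded_linear_imp_has_derivative[OF bQ] this]
  have "((\<lambda>w. P (lorenz a b c d (inv P w))) has_derivative (\<lambda>w. P (A (inv P w)))) (at 0)"
    by (rule bounded_linear.has_derivative[OF bP])
  then have PAQ: "(\<lambda>w. P (A (inv P w))) = N"
    using D by (simp add: transformed_def has_derivative_unique)
  have A_inv: "A (inv P w) = inv P (N w)" for w
    using arg_cong[OF fun_cong[OF PAQ, of w], of "inv P"] by (simp add: QP)
  obtain x1 y1 z1 where v1: "inv P (1, 0, 0) = (x1, y1, z1)"
    by (metis prod_cases3)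
  obtain x2 y2 z2 where v2: "inv P (0, 1, 0) = (x2, y2, z2)"
    by (metis prod_cases3)
  have "(x1, y1, z1) \<noteq> 0"
    using PQ[of "(1, 0, 0)"] v1 linear_0[OF lP] by (auto simp: zero_prod_def)
  moreover have "A (x1, y1, z1) = 0"
    using A_inv[of "(1, 0, 0)"] v1 linear_0[OF bounded_linear.linear[OF bQ]] by (simp add: N_def zero_prod_def)
  moreover have "A (x2, y2, z2) = (x1, y1, z1)"
    using A_inv[of "(0, 1, 0)"] v1 v2 by (simp add: N_def)
  ultimately have nz: "x1 \<noteq> 0" and 1: "y1 = x1" "b * x1 + c * x1 = 0" and 2: "a * (y2 - x2) = x1" "b * x2 + c * y2 = x1"
    using a d by (auto simp: A_def zero_prod_def)
  have b: "b = - c"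
    using 1(2) nz by (simp flip: distrib_right)
  have "(c - a) * (y2 - x2) = 0"
    using 2 b by (simp add: algebra_simps)
  moreover have "y2 - x2 \<noteq> 0"
    using 2 nz by auto
  ultimately show ?thesis
    using b by auto
qed

section \<open>Solutions under linear coordinates and on center manifolds\<close>

lemma transformed_solution:
  fixes F :: "'a::euclidean_space \<Rightarrow> 'a"
  assumes P: "linear P" "bij P" and sol: "solution_on J F \<gamma>"
  shows "solution_on J (transformed P 0 F) (\<lambda>t. P (\<gamma> t))"
  unfolding solution_on_def
proof
  fix t assume "t \<in> J"
  then have "(\<gamma> has_vector_derivative F (\<gamma> t)) (at t within J)"
    using sol by (simp add: solution_on_def)
  from bounded_linear.has_vector_derivative[OF P(1)[unfolded linear_conv_bounded_linear] this]
  show "((\<lambda>t. P (\<gamma> t)) has_vector_derivative transformed P 0 F (P (\<gamma> t))) (at t within J)"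
    using P(2) by (simp add: transformed_def bij_def)
qed

lemma transformed_solution_inv:
  fixes F :: "'a::euclidean_space \<Rightarrow> 'a"
  assumes P: "linear P" "bij P" and sol: "solution_on J (transformed P 0 F) \<gamma>"
  shows "solution_on J F (\<lambda>t. inv P (\<gamma> t))"
  unfolding solution_on_def
proof
  fix t assume "t \<in> J"
  then have "(\<gamma> has_vector_derivative P (F (inv P (\<gamma> t)))) (at t within J)"
    using sol by (simp add: solution_on_def transformed_def)
  from bounded_linear.has_vector_derivative[OF bij_linear_inv_bounded_linear[OF P] this]
  show "((\<lambda>t. inv P (\<gamma> t)) has_vector_derivative F (inv P (\<gamma> t))) (at t within J)"
    using P by (simp add: bij_def)
qed

text \<open>Invariance is a statement about solutions of \<open>G\<close>, so it yields the invariance equation for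
  \<open>h\<close> only at points through which a solution exists.\<close>

lemma invariant_graph_equation:
  assumes inv: "invariant_graph G U h" and U: "open U" "q \<in> U"
    and h: "(h has_derivative h') (at q)"
    and e: "0 < e" and sol: "solution_on {-e<..<e} G \<sigma>" and \<sigma>0: "\<sigma> 0 = (fst q, snd q, h q)"
  shows "h' (restricted G h q) = snd (snd (G (fst q, snd q, h q)))"
proof -
  define \<pi> where "\<pi> = (\<lambda>t. (fst (\<sigma> t), fst (snd (\<sigma> t))))"
  have \<sigma>': "(\<sigma> has_vector_derivative G (\<sigma> 0)) (at 0)"
  proof -
    have 0: "0 \<in> {-e<..<e}"
      using e by simp
    from sol[unfolded solution_on_def, THEN bspec, OF 0]
    show ?thesis
      unfolding at_within_open[OF 0 open_greaterThanLessThan] .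
  qed
  note fst' = bounded_linear.has_vector_derivative[OF bounded_linear_fst]
  note snd' = bounded_linear.has_vector_derivative[OF bounded_linear_snd]
  have \<pi>0: "\<pi> 0 = q"
    by (simp add: \<pi>_def \<sigma>0)
  have \<pi>': "(\<pi> has_vector_derivative restricted G h q) (at 0)"
    using has_vector_derivative_Pair[OF fst'[OF \<sigma>'] fst'[OF snd'[OF \<sigma>']]]
    by (simp add: \<pi>_def restricted_def split_beta \<sigma>0)
  then have "isCont \<pi> 0"
    by (rule has_vector_derivative_continuous)
  \<comment> \<open>Invariance applies only while the projection stays in \<open>U\<close>, so the
    time interval is shrunk accordingly.\<close>
  then have "\<forall>\<^sub>F t in nhds 0. \<pi> t \<in> U"
    unfolding isCont_def tendsto_at_iff_tendsto_nhds
    by (rule topological_tendstoD) (use U \<pi>0 in auto)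
  then obtain \<delta> where \<delta>: "0 < \<delta>" "\<And>t. \<bar>t\<bar> < \<delta> \<Longrightarrow> \<pi> t \<in> U"
    by (auto simp: eventually_nhds_metric)
  define J where "J = {- min e \<delta><..<min e \<delta>}"
  have "0 \<in> J"
    using e \<delta> by (simp add: J_def)
  have "J \<subseteq> {-e<..<e}"
    by (auto simp: J_def)
  then have "solution_on J G \<sigma>"
    using sol has_vector_derivative_within_subset unfolding solution_on_def by blast
  moreover have "\<sigma> 0 \<in> graph_over U h"
    using U by (auto simp: graph_over_def \<sigma>0)
  moreover have "(fst (\<sigma> t), fst (snd (\<sigma> t))) \<in> U" if "t \<in> J" for t
    using that \<delta>(2)[of t] by (auto simp: J_def \<pi>_def)
  moreover have "is_interval J"
    by (simp add: J_def is_interval_oo)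
  ultimately have "\<sigma> t \<in> graph_over U h" if "t \<in> J" for t
    using inv that \<open>0 \<in> J\<close> unfolding invariant_graph_def by blast
  then have eq: "h (\<pi> t) = snd (snd (\<sigma> t))" if "t \<in> J" for t
    using that by (force simp: graph_over_def \<pi>_def)
  \<comment> \<open>The height along the solution is differentiated twice: by the chain rule through
    \<open>h\<close>, and as the third component of \<open>\<sigma>\<close>.\<close>
  have "((\<lambda>t. h (\<pi> t)) has_vector_derivative h' (restricted G h q)) (at 0)"
    using vector_derivative_diff_chain_within[OF \<pi>' has_derivative_at_withinI[OF h[folded \<pi>0]]]
    unfolding o_def .
  moreover have "((\<lambda>t. h (\<pi> t)) has_vector_derivative snd (snd (G (\<sigma> 0)))) (at 0)"
    using \<open>0 \<in> J\<close> eq[symmetric]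
    by (intro has_vector_derivative_transform_within_open[OF snd'[OF snd'[OF \<sigma>']], of J])
      (simp_all add: J_def)
  ultimately show ?thesis
    unfolding \<sigma>0 by (rule vector_derivative_unique_at)
qed

text \<open>By the chain rule, the invariance equation is exactly what the third component needs.
  Periodic orbits of the planar system thus become periodic orbits in space.\<close>

lemma lift_solution_to_graph:
  assumes sol: "solution_on UNIV (restricted G h) \<gamma>"
    and h: "\<And>t. (h has_derivative h' (\<gamma> t)) (at (\<gamma> t))"
    and eq: "\<And>t. h' (\<gamma> t) (restricted G h (\<gamma> t)) = snd (snd (G (fst (\<gamma> t), snd (\<gamma> t), h (\<gamma> t))))"
  shows "solution_on UNIV G (\<lambda>t. (fst (\<gamma> t), snd (\<gamma> t), h (\<gamma> t)))"
  unfolding solution_on_def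
proof
  fix t
  have D: "(\<gamma> has_vector_derivative restricted G h (\<gamma> t)) (at t)"
    using sol by (simp add: solution_on_def)
  have "((\<lambda>t. h (\<gamma> t)) has_vector_derivative h' (\<gamma> t) (restricted G h (\<gamma> t))) (at t)"
    using vector_derivative_diff_chain_within[OF D has_derivative_at_withinI[OF h]]
    by (simp add: o_def)
  then have "((\<lambda>t. (fst (\<gamma> t), snd (\<gamma> t), h (\<gamma> t))) has_vector_derivative
      (fst (restricted G h (\<gamma> t)), snd (restricted G h (\<gamma> t)), snd (snd (G (fst (\<gamma> t), snd (\<gamma> t), h (\<gamma> t)))))) (at t)"
    unfolding eq
    by (intro has_vector_derivative_Pair bounded_linear.has_vector_derivative[OF bounded_linear_fst D]
        bounded_linear.has_vector_derivative[OF bounded_linear_snd D])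
  then show "((\<lambda>t. (fst (\<gamma> t), snd (\<gamma> t), h (\<gamma> t))) has_vector_derivative G (fst (\<gamma> t), snd (\<gamma> t), h (\<gamma> t))) (at t)"
    by (simp add: restricted_def split_beta)
qed

lemma lorenz_center_imp:
  assumes center: "nilpotent_center_on_center_manifold r (lorenz a b c d) 0"
    and a: "a \<noteq> 0" and d: "d \<noteq> 0" and r: "1 \<le> r"
  shows "b = -a \<and> c = a \<and> d = -2 * a"
proof -
  from center obtain P \<mu> U h where nil: "nilpotent_coords (lorenz a b c d) 0 P \<mu>"
    and cm: "center_manifold r (transformed P 0 (lorenz a b c d)) U h"
    and pc: "planar_center U (restricted (transformed P 0 (lorenz a b c d)) h) 0"
    unfolding nilpotent_center_on_center_manifold_def by blast
  note bc = lorenz_nilpotent_coords_imp[OF nil a d]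
  define G where "G = transformed P 0 (lorenz a b c d)"
  have P: "linear P" "bij P"
    using nil by (auto simp: nilpotent_coords_def)
  have U: "open U" and inv: "invariant_graph G U h" and "class_C r U h"
    using cm by (auto simp: center_manifold_def G_def)
  \<comment> \<open>Here \<open>r \<ge> 1\<close> is used: \<open>h\<close> must be differentiable
    on all of \<open>U\<close>.\<close>
  then have h: "(h has_derivative frechet_derivative h (at q)) (at q)" if "q \<in> U" for q
    using r that by (cases r) (auto simp flip: frechet_derivative_works)
  have eq: "frechet_derivative h (at q) (restricted G h q) = snd (snd (G (fst q, snd q, h q)))"
    if q: "q \<in> U" for q
  proof -
    obtain e \<sigma> where "0 < e" and \<sigma>0: "\<sigma> 0 = inv P (fst q, snd q, h q)"
      and "solution_on {-e<..<e} (lorenz a b c d) \<sigma>"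
      using lorenz_local_solution by metis
    from transformed_solution[OF P this(3)] show ?thesis
      unfolding G_def[symmetric]
      by (rule invariant_graph_equation[OF inv U q h[OF q] \<open>0 < e\<close>])
        (use P in \<open>simp add: \<sigma>0 bij_def surj_f_inv_f\<close>)
  qed
  from pc obtain V where V: "open V" "0 \<in> V" "V \<subseteq> U"
    and orbit: "\<And>q. q \<in> V - {0} \<Longrightarrow> \<exists>\<gamma> T. T > 0 \<and> solution_on UNIV (restricted G h) \<gamma> \<and> \<gamma> 0 = q \<and>
          (\<forall>t. \<gamma> (t + T) = \<gamma> t) \<and> range \<gamma> \<subseteq> V - {0}"
    unfolding planar_center_def G_def[symmetric] by meson
  \<comment> \<open>An open set is never a singleton, so \<open>V\<close> contains a point on a
    periodic orbit that avoids the origin.\<close>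
  have "V \<noteq> {0}"
    using V(1) not_open_singleton by blast
  then obtain q where "q \<in> V - {0}"
    using V(2) by blast
  from orbit[OF this] obtain \<gamma> T where T: "T > 0" and \<gamma>: "solution_on UNIV (restricted G h) \<gamma>"
    and per: "\<And>t. \<gamma> (t + T) = \<gamma> t" and ran: "\<And>t. \<gamma> t \<in> V - {0}"
    by blast
  have "solution_on UNIV G (\<lambda>t. (fst (\<gamma> t), snd (\<gamma> t), h (\<gamma> t)))"
  proof (rule lift_solution_to_graph[OF \<gamma>, where h' = "\<lambda>q. frechet_derivative h (at q)"])
    show "(h has_derivative frechet_derivative h (at (\<gamma> t))) (at (\<gamma> t))" for t
      using h ran V(3) by blast
    show "frechet_derivative h (at (\<gamma> t)) (restricted G h (\<gamma> t)) =
        snd (snd (G (fst (\<gamma> t), snd (\<gamma> t), h (\<gamma> t))))" for t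
      using ran V(3) by (intro eq) blast
  qed
  from transformed_solution_inv[OF P this[unfolded G_def]]
  have lift: "solution_on UNIV (lorenz a (-a) a d) (\<lambda>t. inv P (fst (\<gamma> t), snd (\<gamma> t), h (\<gamma> t)))"
    using bc by simp
  have "d = -2 * a"
  proof (rule ccontr)
    assume "d \<noteq> -2 * a"
    from lorenz_periodic_solution_trivial[OF lift _ T a d this, of 0] per
    have "inv P (fst (\<gamma> 0), snd (\<gamma> 0), h (\<gamma> 0)) = 0"
      by simp
    then have "(fst (\<gamma> 0), snd (\<gamma> 0), h (\<gamma> 0)) = 0"
      using P by (metis bij_inv_eq_iff linear_0)
    then show False
      using ran[of 0] by (simp add: zero_prod_def prod_eq_iff)
  qed
  with bc show ?thesis
    by simp
qed


subsection \<open>Sufficiency\<close>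

text \<open>Separation of variables: an antiderivative \<open>F\<close> of \<open>1 / g\<close>
  measures the time needed to reach a position, and the flow is its inverse. \<open>T\<close> is the
  time needed to advance by \<open>p\<close>.\<close>

lemma periodic_scalar_flow:
  fixes g :: "real \<Rightarrow> real"
  assumes cont: "\<And>x. isCont g x" and pos: "\<And>x. 0 < g x" and per: "\<And>x. g (x + p) = g x" and p: "0 < p"
  obtains \<phi> T where "0 < T" "surj \<phi>" "\<And>t. (\<phi> has_real_derivative g (\<phi> t)) (at t)"
    "\<And>t. \<phi> (t + T) = \<phi> t + p"
proof -
  have "isCont (\<lambda>x. 1 / g x) x" for x
    using pos[of x] by (intro continuous_divide continuous_const cont) simp
  then have "\<exists>F. \<forall>x::real. -\<infinity> < ereal x \<longrightarrow> ereal x < \<infinity> \<longrightarrow> (F has_vector_derivative 1 / g x) (at x)"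
    by (intro einterval_antiderivative) simp_all
  then obtain F where F': "\<And>x. (F has_real_derivative 1 / g x) (at x)"
    by (auto simp: has_real_derivative_iff_has_vector_derivative)
  have mono: "F x < F y" if "x < y" for x y
    using DERIV_pos_imp_increasing[OF that, of F] F' divide_pos_pos[OF zero_less_one pos] by blast
  have contF: "isCont F x" for x
    using F' DERIV_isCont by blast
  define T where "T = F p - F 0"
  have T: "0 < T"
    using mono[OF p] by (simp add: T_def)
  have "((\<lambda>x. F (x + p) - F x) has_real_derivative 0) (at x)" for x
    using DERIV_diff[OF DERIV_shift[THEN iffD1, OF F'[of "x + p"]] F'[of x]] by (simp add: per)
  then have shift: "F (x + p) = F x + T" for x
    using DERIV_isconst_all[of "\<lambda>x. F (x + p) - F x" x 0] by (simp add: T_def)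
  \<comment> \<open>Iterating the shift shows that \<open>F\<close> is unbounded in both directions,
    so its inverse is defined for all times.\<close>
  have shiftn: "F (x + real n * p) = F x + real n * T" for n x
  proof (induction n)
    case (Suc n)
    then show ?case
      using shift[of "x + real n * p"] by (simp add: algebra_simps)
  qed simp
  have "\<exists>x. F x = y" for y
  proof -
    obtain n where n: "\<bar>y - F 0\<bar> < real n * T"
      using reals_Archimedean3[OF T] by blast
    have "F (real n * p) = F 0 + real n * T" "F (- (real n * p)) + real n * T = F 0"
      using shiftn[of 0 n] shiftn[of "- (real n * p)" n] by simp_all
    with n have "F (- (real n * p)) \<le> y" "y \<le> F (real n * p)"
      by linarith+
    then show ?thesis
      using IVT[of F "- (real n * p)" y "real n * p"] p contF by force
  qed
  then have "surj F"
    by (metis surjI)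
  moreover have "inj F"
    using mono by (metis injI linorder_neqE_linordered_idom less_irrefl)
  ultimately have FG: "F (inv F t) = t" and GF: "inv F (F x) = x" for t x
    by (simp_all add: surj_f_inv_f)
  have contG: "isCont (inv F) t" for t
    using isCont_inverse_function[of 1 "inv F t" "inv F" F] GF contF FG by simp
  show thesis
  proof (rule that[OF T])
    show "surj (inv F)"
      using GF by (metis surjI)
    show "(inv F has_real_derivative g (inv F t)) (at t)" for t
      using DERIV_inverse_function[OF F', where a = "t - 1" and b = "t + 1"] contG FG pos[of "inv F t"]
      by force
    show "inv F (t + T) = inv F t + p" for t
      using shift[of "inv F t"] FG[of t] GF by metis
  qed
qed

text \<open>The energy \<open>y\<^sup>2 + x\<^sup>4 / 4\<close> of \<open>x' = y\<close>, \<open>y' = - x\<^sup>3 / 2\<close> is positive definite.  On the level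
  \<open>A\<^sup>4 / 4\<close> put \<open>x = A sin \<phi>\<close>, \<open>y = A\<^sup>2 / 2 cos \<phi> \<surd>(1 + sin\<^sup>2 \<phi>)\<close>; the system becomes the
  scalar equation \<open>\<phi>' = A / 2 \<surd>(1 + sin\<^sup>2 \<phi>)\<close>.\<close>

lemma duffing_planar_center:
  "planar_center UNIV (\<lambda>(x, y). (y, - (x ^ 3) / 2)) 0"
  unfolding planar_center_def
proof (intro exI[of _ UNIV] conjI ballI)
  fix q :: "real \<times> real"
  assume q: "q \<in> UNIV - {0}"
  define g where "g = (\<lambda>s::real. sqrt (1 + (sin s)\<^sup>2))"
  \<comment> \<open>Four times the energy, so that the level through \<open>q\<close> is
    \<open>A ^ 4\<close> with \<open>A\<close> the largest value of \<open>x\<close> on it.\<close>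
  define E where "E = (\<lambda>v :: real \<times> real. (fst v) ^ 4 + 4 * (snd v)\<^sup>2)"
  have E0: "E q > 0"
    using q by (auto simp: E_def zero_prod_def prod_eq_iff add_pos_nonneg add_nonneg_pos)
  define A where "A = root 4 (E q)"
  have A: "A > 0" "A ^ 4 = E q"
    using E0 by (simp_all add: A_def)
  have g1: "1 \<le> g s" and g2: "(g s)\<^sup>2 = 1 + (sin s)\<^sup>2" for s
    by (simp_all add: g_def)
  have g0: "0 < g s" for s
    using g1[of s] by linarith
  obtain \<phi> T where T: "0 < T" and surj: "surj \<phi>"
    and \<phi>': "\<And>t. (\<phi> has_real_derivative A / 2 * g (\<phi> t)) (at t)"
    and \<phi>T: "\<And>t. \<phi> (t + T) = \<phi> t + 2 * pi"
  proof (rule periodic_scalar_flow[of "\<lambda>s. A / 2 * g s" "2 * pi"])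
    show "isCont (\<lambda>s. A / 2 * g s) x" for x
      unfolding g_def by (intro continuous_intros)
  qed (use A g0 in \<open>auto simp: g_def\<close>)
  define C where "C = (\<lambda>s. (A * sin s, A\<^sup>2 / 2 * cos s * g s))"
  have EC: "E (C s) = E q" for s
  proof -
    have "E (C s) = A ^ 4 * ((sin s) ^ 4 + (cos s)\<^sup>2 * (g s)\<^sup>2)"
      by (simp add: E_def C_def power_mult_distrib algebra_simps power_divide flip: power_mult)
    also have "(sin s) ^ 4 + (cos s)\<^sup>2 * (g s)\<^sup>2 = 1"
      unfolding g2 cos_squared_eq by (simp add: algebra_simps flip: power_add)
    finally show ?thesis
      by (simp add: A)
  qed
  \<comment> \<open>In the scaled coordinates \<open>m\<close>, \<open>k\<close> the level is
    \<open>m ^ 4 + k\<^sup>2 = 1\<close>. Factoring \<open>1 - m ^ 4\<close> puts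
    \<open>(n, m)\<close> on the unit circle, whose angle is the parameter \<open>s\<close>.\<close>
  have level: "\<exists>s. C s = v" if "E v = E q" for v
  proof -
    define m where "m = fst v / A"
    define k where "k = 2 * snd v / A\<^sup>2"
    define n where "n = k / sqrt (1 + m\<^sup>2)"
    have m2: "1 + m\<^sup>2 > 0"
      by (simp add: add_pos_nonneg)
    have "m ^ 4 + k\<^sup>2 = E v / A ^ 4"
      using A(1) by (simp add: m_def k_def E_def power_divide power_mult_distrib add_divide_distrib flip: power_mult)
    also have "\<dots> = 1"
      using that A E0 by simp
    finally have k2: "k\<^sup>2 = (1 - m\<^sup>2) * (1 + m\<^sup>2)"
      by (simp add: algebra_simps flip: power_add)
    have "n\<^sup>2 = k\<^sup>2 / (1 + m\<^sup>2)"
      using m2 by (simp add: n_def power_divide)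
    also have "\<dots> = 1 - m\<^sup>2"
      using m2 unfolding k2 by simp
    finally have "n\<^sup>2 = 1 - m\<^sup>2" .
    then obtain s where s: "n = cos s" "m = sin s"
      using sincos_total_2pi[of n m] by auto
    have "fst v = A * sin s"
      using A by (simp add: m_def flip: s)
    moreover have "snd v = A\<^sup>2 / 2 * cos s * g s"
      using A m2 by (simp add: g_def n_def k_def flip: s)
    ultimately have "C s = v"
      by (simp add: C_def prod_eq_iff)
    then show ?thesis ..
  qed
  obtain s0 where "C s0 = q"
    using level by blast
  then obtain t0 where t0: "C (\<phi> t0) = q"
    using surj by (metis surjD)
  define \<gamma> where "\<gamma> = (\<lambda>t. C (\<phi> (t + t0)))"
  \<comment> \<open>The orbit fills its whole energy level, so its complement can be studied through
    \<open>E\<close> alone.\<close>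
  have range: "range \<gamma> = {v. E v = E q}"
  proof -
    have "v \<in> range \<gamma>" if Ev: "E v = E q" for v
    proof -
      obtain s where "C s = v"
        using level[OF Ev] by blast
      moreover obtain t where "s = \<phi> t"
        using surj by blast
      ultimately have "\<gamma> (t - t0) = v"
        by (simp add: \<gamma>_def)
      then show ?thesis
        by blast
    qed
    then show ?thesis
      using EC by (auto simp: \<gamma>_def)
  qed
  have C1: "((\<lambda>s. A * sin s) has_real_derivative A * cos s) (at s)" for s
    by (auto intro!: derivative_eq_intros)
  have C2: "((\<lambda>s. A\<^sup>2 / 2 * cos s * g s) has_real_derivative - (A\<^sup>2 * (sin s) ^ 3 / g s)) (at s)" for s
  proof -
    have "0 < 1 + (sin s)\<^sup>2"
      by (simp add: add_pos_nonneg)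
    then have "(g has_real_derivative sin s * cos s / g s) (at s)"
      unfolding g_def by (auto intro!: derivative_eq_intros simp: field_simps)
    then have "((\<lambda>s. A\<^sup>2 / 2 * cos s * g s) has_real_derivative
        A\<^sup>2 / 2 * (- sin s * g s + cos s * (sin s * cos s / g s))) (at s)"
      using g0[of s] by (auto intro!: derivative_eq_intros simp: field_simps)
    also have "- sin s * g s + cos s * (sin s * cos s / g s) = sin s * ((cos s)\<^sup>2 - (g s)\<^sup>2) / g s"
      using g0[of s] by (simp add: field_simps power2_eq_square)
    also have "(cos s)\<^sup>2 - (g s)\<^sup>2 = - 2 * (sin s)\<^sup>2"
      by (simp add: g2 cos_squared_eq)
    finally show ?thesis
      by (simp add: power3_eq_cube power2_eq_square mult.assoc)
  qed
  have "solution_on UNIV (\<lambda>(x, y). (y, - (x ^ 3) / 2)) \<gamma>"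
    unfolding solution_on_def
  proof
    fix t
    have ph: "((\<lambda>t. \<phi> (t + t0)) has_real_derivative A / 2 * g (\<phi> (t + t0))) (at t)"
      using DERIV_shift[THEN iffD1, OF \<phi>'[of "t + t0"]] .
    define s where "s = \<phi> (t + t0)"
    have 1: "((\<lambda>t. A * sin (\<phi> (t + t0))) has_real_derivative A * cos s * (A / 2 * g s)) (at t)"
      using DERIV_chain2[OF C1 ph] by (simp add: s_def)
    have 2: "((\<lambda>t. A\<^sup>2 / 2 * cos (\<phi> (t + t0)) * g (\<phi> (t + t0))) has_real_derivative
        - (A\<^sup>2 * (sin s) ^ 3 / g s) * (A / 2 * g s)) (at t)"
      using DERIV_chain2[OF C2 ph] by (simp add: s_def)
    have "(\<gamma> has_vector_derivative (A * cos s * (A / 2 * g s), - (A\<^sup>2 * (sin s) ^ 3 / g s) * (A / 2 * g s))) (at t)"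
      unfolding \<gamma>_def C_def
      using 1 2 unfolding has_real_derivative_iff_has_vector_derivative
      by (rule has_vector_derivative_Pair)
    moreover have "(A * cos s * (A / 2 * g s), - (A\<^sup>2 * (sin s) ^ 3 / g s) * (A / 2 * g s)) =
        (case \<gamma> t of (x, y) \<Rightarrow> (y, - (x ^ 3) / 2))"
      using g0[of s] by (simp add: \<gamma>_def C_def s_def power2_eq_square power3_eq_cube)
    ultimately show "(\<gamma> has_vector_derivative (case \<gamma> t of (x, y) \<Rightarrow> (y, - (x ^ 3) / 2))) (at t within UNIV)"
      by simp
  qed
  moreover have "\<gamma> 0 = q"
    using t0 by (simp add: \<gamma>_def)
  moreover have "\<gamma> (t + T) = \<gamma> t" for t
    using \<phi>T[of "t + t0"] by (simp add: \<gamma>_def C_def g_def add_ac)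
  moreover have "E 0 = 0"
    by (simp add: E_def)
  then have "range \<gamma> \<subseteq> UNIV - {0}"
    using E0 unfolding range by auto
  moreover have "0 \<in> inside (range \<gamma>)"
  proof -
    \<comment> \<open>On the component \<open>K\<close> of 0 the values of \<open>E\<close> form a
      connected set that contains 0 and misses \<open>E q\<close>. Hence \<open>E < E q\<close> on
      \<open>K\<close>, and sublevel sets of \<open>E\<close> are bounded.\<close>
    define K where "K = connected_component_set (- range \<gamma>) 0"
    have 0: "0 \<in> - range \<gamma>"
      using \<open>range \<gamma> \<subseteq> UNIV - {0}\<close> by auto
    have "continuous_on K E"
      unfolding E_def by (intro continuous_intros)
    then have "connected (E ` K)"
      by (intro connected_continuous_image) (simp_all add: K_def)
    moreover have "0 \<in> E ` K"
      using 0 \<open>E 0 = 0\<close> by (metis K_def connected_component_refl image_eqI mem_Collect_eq)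
    moreover have "E q \<notin> E ` K"
      using connected_component_subset[of "- range \<gamma>" 0] unfolding K_def range by fastforce
    ultimately have lt: "E v < E q" if "v \<in> K" for v
      using connectedD_interval[of "E ` K" 0 "E v" "E q"] that E0 by fastforce
    have "bounded K"
      unfolding bounded_iff
    proof (intro exI ballI)
      fix v
      assume "v \<in> K"
      then have v: "(fst v) ^ 4 + 4 * (snd v)\<^sup>2 < E q"
        using lt unfolding E_def by blast
      have x4: "0 \<le> (fst v) ^ 4"
        by simp
      \<comment> \<open>This follows from \<open>(x\<^sup>2 - 1 / 2)\<^sup>2 \<ge> 0\<close> and
        lets the quartic term control the norm.\<close>
      have "(fst v)\<^sup>2 \<le> 1 + (fst v) ^ 4"
        using sum_squares_ge_zero[of "(fst v)\<^sup>2 - 1 / 2" 0]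
        by (simp add: power4_eq_xxxx power2_eq_square algebra_simps)
      moreover have "0 \<le> (snd v)\<^sup>2"
        by simp
      ultimately have "(fst v)\<^sup>2 + (snd v)\<^sup>2 \<le> 1 + E q"
        using v x4 by linarith
      then show "norm v \<le> sqrt (1 + E q)"
        by (simp add: norm_prod_def)
    qed
    then show ?thesis
      using 0 by (simp add: inside_def K_def)
  qed
  ultimately show "\<exists>\<gamma> T. T > 0 \<and> solution_on UNIV (\<lambda>(x, y). (y, - (x ^ 3) / 2)) \<gamma> \<and> \<gamma> 0 = q \<and>
      (\<forall>t. \<gamma> (t + T) = \<gamma> t) \<and> range \<gamma> \<subseteq> UNIV - {0} \<and> 0 \<in> inside (range \<gamma>)"
    using T by blast
qed auto

section \<open>Smoothness of the explicit center manifold\<close>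

lemma class_C_const: "class_C r S (\<lambda>_. k)"
  by (induction r arbitrary: k) simp_all

lemma class_C_bounded_linear:
  assumes "bounded_linear f"
  shows "class_C r S f"
proof (cases r)
  case 0
  then show ?thesis
    using assms by (simp add: linear_continuous_on)
next
  case (Suc n)
  have D: "(f has_derivative f) (at x)" for x
    using assms by (rule bounded_linear_imp_has_derivative)
  have "frechet_derivative f (at x) = f" for x
    using frechet_derivative_at[OF D] by simp
  then show ?thesis
    using Suc D by (auto simp: class_C_const differentiable_def)
qed

text \<open>Each directional derivative of this function is linear in the base point, which reduces
  the claim to the linear case.\<close>

lemma class_C_fst_square: "class_C r S (\<lambda>v :: real \<times> real. (fst v)\<^sup>2 / k)"
proof (cases r)
  case 0
  then show ?thesis
    by (simp, unfold divide_inverse, intro continuous_intros)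
next
  case (Suc n)
  define f where "f = (\<lambda>v :: real \<times> real. (fst v)\<^sup>2 / k)"
  have D: "(f has_derivative (\<lambda>w. 2 * fst v * fst w / k)) (at v)" for v
    unfolding f_def by (auto intro!: derivative_eq_intros simp: divide_inverse)
  have F: "frechet_derivative f (at v) = (\<lambda>w. 2 * fst v * fst w / k)" for v
    using frechet_derivative_at[OF D] by simp
  have "bounded_linear (\<lambda>v :: real \<times> real. 2 * fst v * fst w / k)" for w :: "real \<times> real"
    unfolding linear_conv_bounded_linear[symmetric]
    by (auto intro!: linearI simp: algebra_simps add_divide_distrib)
  then have "class_C (Suc n) S f"
    using differentiableI[OF D] by (simp add: F class_C_bounded_linear)
  then show ?thesis
    using Suc by (simp add: f_def)
qed

lemma lorenz_center:
  assumes a: "a \<noteq> 0"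
  shows "nilpotent_center_on_center_manifold r (lorenz a (-a) a (-2 * a)) 0"
proof -
  \<comment> \<open>The second new coordinate is \<open>x'\<close> itself, as the normal form
    \<open>x' = y\<close> demands; \<open>Q\<close> is the inverse change of variables.\<close>
  define P :: "real \<times> real \<times> real \<Rightarrow> real \<times> real \<times> real" where "P = (\<lambda>(x, y, z). (x, a * (y - x), z))"
  define Q :: "real \<times> real \<times> real \<Rightarrow> real \<times> real \<times> real" where "Q = (\<lambda>(x, y, z). (x, x + y / a, z))"
  define h :: "real \<times> real \<Rightarrow> real" where "h = (\<lambda>v. (fst v)\<^sup>2 / (2 * a))"
  define F where "F = lorenz a (-a) a (-2 * a)"
  define G where "G = (\<lambda>(x, y, z). (y, - (a * x * z), - 2 * a * z + x * (x + y / a)))"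
  have PQ: "P (Q v) = v" and QP: "Q (P v) = v" for v
    using a by (auto simp: P_def Q_def split: prod.splits)
  have Q: "inv P = Q"
    using QP PQ by (rule inv_equality)
  have G: "transformed P 0 F = G"
    unfolding transformed_def Q using a
    by (auto simp: fun_eq_iff F_def P_def Q_def G_def lorenz_def field_simps)
  have "nilpotent_coords F 0 P (2 * a)"
    unfolding nilpotent_coords_def G
  proof (intro conjI)
    show "F 0 = 0"
      by (simp add: F_def lorenz_def zero_prod_def)
    show "linear P"
      by (rule linearI) (auto simp: P_def algebra_simps)
    show "bij P"
      using PQ QP by (metis bijI')
    show "(G has_derivative (\<lambda>(x, y, z). (y, 0, - (2 * a) * z))) (at 0)"
      unfolding G_def split_beta divide_inverse
      by (auto intro!: derivative_eq_intros simp: algebra_simps)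
  qed (use a in simp)
  moreover have "center_manifold r G UNIV h"
    unfolding center_manifold_def
  proof (intro conjI)
    show "class_C r UNIV h"
      unfolding h_def by (rule class_C_fst_square)
    show "(h has_derivative (\<lambda>_. 0)) (at 0)"
      unfolding h_def divide_inverse by (auto intro!: derivative_eq_intros)
    show "invariant_graph G UNIV h"
      unfolding invariant_graph_def
    proof (intro allI impI ballI, elim conjE bexE)
      fix J \<gamma> s t
      assume J: "is_interval J" and sol: "solution_on J G \<gamma>" and s: "s \<in> J" "\<gamma> s \<in> graph_over UNIV h" and t: "t \<in> J"
      define x where "x = (\<lambda>t. fst (\<gamma> t))"
      define y where "y = (\<lambda>t. fst (snd (\<gamma> t)))"
      define z where "z = (\<lambda>t. snd (snd (\<gamma> t)))"
      \<comment> \<open>The defect \<open>z - x\<^sup>2 / (2 * a)\<close> satisfies the linear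
        equation \<open>v' = - 2 * a * v\<close>, so the exponential factor makes \<open>w\<close>
        constant. If \<open>w\<close> vanishes at one time, the solution stays on the
        surface.\<close>
      define w where "w = (\<lambda>t. (z t - (x t)\<^sup>2 / (2 * a)) * exp (2 * a * t))"
      note fst' = bounded_linear.has_vector_derivative[OF bounded_linear_fst]
      note snd' = bounded_linear.has_vector_derivative[OF bounded_linear_snd]
      have "(w has_real_derivative 0) (at t within J)" if "t \<in> J" for t
      proof -
        have D: "(\<gamma> has_vector_derivative G (\<gamma> t)) (at t within J)"
          using sol that by (simp add: solution_on_def)
        have x': "(x has_real_derivative y t) (at t within J)"
          and z': "(z has_real_derivative - 2 * a * z t + x t * (x t + y t / a)) (at t within J)"
          using fst'[OF D] snd'[OF snd'[OF D]]
          by (simp_all add: has_real_derivative_iff_has_vector_derivative x_def y_def z_def G_def split_beta)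
        show ?thesis
          unfolding w_def using a
          by (auto intro!: derivative_eq_intros x' z' simp: field_simps power2_eq_square)
      qed
      then obtain k where k: "\<And>t. t \<in> J \<Longrightarrow> w t = k"
        using has_field_derivative_zero_constant[OF is_interval_convex[OF J]] by blast
      have "w s = 0"
        using s(2) by (auto simp: graph_over_def w_def h_def x_def z_def)
      then have "w t = 0"
        using k[OF s(1)] k[OF t] by simp
      then show "\<gamma> t \<in> graph_over UNIV h"
        by (auto simp: graph_over_def w_def h_def x_def z_def prod_eq_iff)
    qed
  qed (simp_all add: h_def)
  \<comment> \<open>Inserting \<open>z = x\<^sup>2 / (2 * a)\<close> into
    \<open>y' = - a x z\<close> removes the parameter \<open>a\<close>.\<close>
  moreover have "restricted G h = (\<lambda>(x, y). (y, - (x ^ 3) / 2))"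
    using a by (auto simp: fun_eq_iff restricted_def G_def h_def power2_eq_square power3_eq_cube)
  then have "planar_center UNIV (restricted G h) 0"
    using duffing_planar_center by simp
  ultimately show ?thesis
    unfolding nilpotent_center_on_center_manifold_def F_def[symmetric] by (metis G)
qed

theorem theorem39:
  fixes a b c d :: real and r :: nat
  assumes "a * d \<noteq> 0" and "r \<ge> 1"
  shows "nilpotent_center_on_center_manifold r (lorenz a b c d) 0 \<longleftrightarrow>
           b = - a \<and> c = a \<and> d = - 2 * a"
  using assms lorenz_center_imp[of r a b c d] lorenz_center[of a r] by auto

end
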